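(* Let $a<b<c$ be a three-letter alphabet, and let $w=w_1w_2\dots w_m$ be a word in this alphabet in which each of the letters $a,b,c$ appears at least once. Then $\mathrm{Curv}(w)$ is invariant under cyclic permutations of the characters of $w$ (that is, $\mathrm{Curv}(w_2w_3\dots w_mw_1)=\mathrm{Curv}(w_1w_2\dots w_m)$, and hence $\mathrm{Curv}$ depends only on the cyclic word represented by $w$), and it is given explicitly by $$\mathrm{Curv}(w) = -\frac{t^+ - t^-}{2\,(t^+ + t^-)},$$ where $t^+$ and $t^-$ are the numbers of oriented and disoriented triangles, respectively, in the cyclic word represented by $w$.
   Context: **Index of a two-letter word.** For a two-letter alphabet $x<y$ and a linear word $u=u_1u_2\dots u_n$ in which both letters appear, let $X=\{i : u_i=x\}$, $Y=\{j : u_j=y\}$, so $X\sqcup Y=\{1,\dots,n\}$. Set $$\mathrm{Ind}(u)=\frac{\#\{(i,j)\in X\times Y : i>j\}-\#\{(i,j)\in X\times Y : i<j\}}{2\,|X|\,|Y|}\in\mathbb{Q}.$$ **Curvature.** For a linear word $w=w_1\dots w_m$ in the alphabet $a<b<c$, let $\delta_0w$, $\delta_1w$, $\delta_2w$ be the words obtained from $w$ by deleting all occurrences of $a$, of $b$, of $c$, respectively; they are regarded as words in the two-letter alphabets $b<c$, $a<c$, $a<b$, respectively. Set $$\mathrm{Curv}(w)=\mathrm{Ind}(\delta_0w)-\mathrm{Ind}(\delta_1w)+\mathrm{Ind}(\delta_2w).$$ **Cyclic words.** A cyclic word is an equivalence class of linear words under cyclic permutation (rotation) of the characters. **Triangles.**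 A triangle in $w$ is a choice of three positions $(i,j,k)$ with $w_i=a$, $w_j=b$, $w_k=c$. It is called oriented if the cyclic order in which the three chosen letters appear in the cyclic word agrees with the cyclic order $(a,b,c)$ of the alphabet, i.e. if $i<j<k$ or $j<k<i$ or $k<i<j$; otherwise it is called disoriented. Let $t^+$ be the number of oriented triangles and $t^-$ the number of disoriented triangles. Thus $t^++t^-=k_0k_1k_2$, where $k_0,k_1,k_2$ are the numbers of occurrences of $a,b,c$ in $w$. *)

theory Defs
  imports Complex_Main
begin

text \<open>Words are lists; positions are counted from 0, which is immaterial because only
  their order matters.\<close>

definition occ :: "'a \<Rightarrow> 'a list \<Rightarrow> nat set" where
  "occ x u = {i. i < length u \<and> u ! i = x}"

text \<open>Index of a word over the two-letter alphabet \<open>x < y\<close> in which both letters appear.\<close>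

definition Ind :: "'a \<Rightarrow> 'a \<Rightarrow> 'a list \<Rightarrow> rat" where
  "Ind x y u =
     (of_nat (card {(i, j) \<in> occ x u \<times> occ y u. i > j})
      - of_nat (card {(i, j) \<in> occ x u \<times> occ y u. i < j}))
     / (2 * of_nat (card (occ x u)) * of_nat (card (occ y u)))"

definition Curv :: "'a \<Rightarrow> 'a \<Rightarrow> 'a \<Rightarrow> 'a list \<Rightarrow> rat" where
  "Curv a b c w =
     Ind b c (removeAll a w) - Ind a c (removeAll b w) + Ind a b (removeAll c w)"

definition cyclic_rel :: "('a list \<times> 'a list) set" where
  "cyclic_rel = {(u, v). \<exists>n. v = rotate n u}"

lemma equiv_cyclic_rel: "equiv UNIV cyclic_rel"
proof (rule equivI)
  show "refl_on UNIV (cyclic_rel :: ('a list \<times> 'a list) set)"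
    unfolding refl_on_def cyclic_rel_def by (auto intro: exI[of _ 0])
  show "sym (cyclic_rel :: ('a list \<times> 'a list) set)"
  proof (rule symI)
    fix u v :: "'a list"
    assume "(u, v) \<in> cyclic_rel"
    then obtain n where v: "v = rotate n u" by (auto simp: cyclic_rel_def)
    show "(v, u) \<in> cyclic_rel"
    proof (cases "u = []")
      case True
      then show ?thesis using v by (auto simp: cyclic_rel_def)
    next
      case False
      then have "n mod length u \<le> length u"
        by (simp add: less_imp_le)
      then have "rotate (length u - n mod length u) v = u"
        by (subst v, subst rotate_conv_mod[of n]) (simp add: rotate_rotate)
      then show ?thesis unfolding cyclic_rel_def by (auto intro: sym)
    qed
  qed
  show "trans (cyclic_rel :: ('a list \<times> 'a list) set)"
    by (rule transI) (auto simp: cyclic_rel_def rotate_rotate)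
qed simp

definition cyclic_word :: "'a list \<Rightarrow> 'a list set" where
  "cyclic_word w = cyclic_rel `` {w}"

definition triangles :: "'a \<Rightarrow> 'a \<Rightarrow> 'a \<Rightarrow> 'a list \<Rightarrow> (nat \<times> nat \<times> nat) set" where
  "triangles a b c w = occ a w \<times> occ b w \<times> occ c w"

definition oriented :: "nat \<times> nat \<times> nat \<Rightarrow> bool" where
  "oriented = (\<lambda>(i, j, k). i < j \<and> j < k \<or> j < k \<and> k < i \<or> k < i \<and> i < j)"

definition t_plus :: "'a \<Rightarrow> 'a \<Rightarrow> 'a \<Rightarrow> 'a list \<Rightarrow> nat" where
  "t_plus a b c w = card {t \<in> triangles a b c w. oriented t}"

definition t_minus :: "'a \<Rightarrow> 'a \<Rightarrow> 'a \<Rightarrow> 'a list \<Rightarrow> nat" where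
  "t_minus a b c w = card {t \<in> triangles a b c w. \<not> oriented t}"

end

theory Submission
  imports Defs
begin

text \<open>Over the common denominator $2 k_0 k_1 k_2$, the numerator of the curvature is the sum over all
  triangles $(i,j,k)$ of $s(j,k) - s(i,k) + s(i,j)$, where $s(p,q)$ is $1$ if $p > q$ and $-1$ if
  $p < q$. That summand is $-1$ on oriented triangles and $1$ on disoriented ones. Moving the first
  letter of the word to its end changes two of the three indices, and the two changes cancel.\<close>

section \<open>Counting ordered pairs of letters\<close>

lemma finite_occ [simp]: "finite (occ x u)"
  by (simp add: occ_def)

lemma occ_Nil [simp]: "occ x [] = {}"
  by (simp add: occ_def)

lemma occ_Cons: "occ x (z # u) = (if z = x then {0} else {}) \<union> Suc ` occ x u"
proof (rule set_eqI)
  fix i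
  show "i \<in> occ x (z # u) \<longleftrightarrow> i \<in> (if z = x then {0} else {}) \<union> Suc ` occ x u"
    by (cases i) (auto simp: occ_def)
qed

lemma card_occ: "card (occ x u) = count_list u x"
  by (induction u) (auto simp: occ_Cons card_image)

text \<open>Both cardinalities in \<open>Ind\<close> have this form, one with the letters exchanged,
  so a single recursion on the list handles both.\<close>

definition precedences :: "'a \<Rightarrow> 'a \<Rightarrow> 'a list \<Rightarrow> nat" where
  "precedences x y u = card {(i, j) \<in> occ x u \<times> occ y u. i < j}"

lemma card_occ_greater: "card {(i, j) \<in> occ x u \<times> occ y u. i > j} = precedences y x u"
proof -
  have "{(i, j) \<in> occ x u \<times> occ y u. i > j} = prod.swap ` {(i, j) \<in> occ y u \<times> occ x u. i < j}"
    by (auto simp: image_iff)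
  then show ?thesis
    by (simp add: precedences_def card_image)
qed

lemma precedences_Nil [simp]: "precedences x y [] = 0"
  by (simp add: precedences_def)

text \<open>The old pairs are shifted by \<open>Suc\<close>. The new position 0 precedes all others,
  so it can only be the first component of a new pair.\<close>

lemma precedences_Cons:
  "precedences x y (z # u) = precedences x y u + (if z = x then count_list u y else 0)"
proof -
  let ?P = "{(i, j) \<in> occ x u \<times> occ y u. i < j}"
  let ?Q = "if z = x then {0 :: nat} \<times> Suc ` occ y u else {}"
  have "{(i, j) \<in> occ x (z # u) \<times> occ y (z # u). i < j} = map_prod Suc Suc ` ?P \<union> ?Q"
    by (auto simp: occ_Cons image_iff map_prod_def split: if_splits)
  moreover have "card (map_prod Suc Suc ` ?P \<union> ?Q) = card (map_prod Suc Suc ` ?P) + card ?Q"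
  proof (rule card_Un_disjoint)
    show "finite (map_prod Suc Suc ` ?P)"
      by (rule finite_imageI, rule finite_subset[of _ "occ x u \<times> occ y u"]) auto
  qed auto
  moreover have "card (map_prod Suc Suc ` ?P) = card ?P"
    by (rule card_image) (auto simp: inj_on_def)
  moreover have "card ?Q = (if z = x then count_list u y else 0)"
    by (simp add: card_cartesian_product card_image card_occ)
  ultimately show ?thesis
    by (simp add: precedences_def)
qed

lemma precedences_snoc:
  assumes "x \<noteq> y"
  shows "precedences x y (u @ [z]) = precedences x y u + (if z = y then count_list u x else 0)"
  using assms by (induction u) (auto simp: precedences_Cons)

lemma count_list_removeAll: "x \<noteq> z \<Longrightarrow> count_list (removeAll z u) x = count_list u x"
  by (induction u) auto

text \<open>Deletion moves positions but keeps the order of the remaining letters. Hence all three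
  indices can be read off from the full word.\<close>

lemma precedences_removeAll:
  assumes "x \<noteq> z" "y \<noteq> z"
  shows "precedences x y (removeAll z u) = precedences x y u"
  using assms by (induction u) (auto simp: precedences_Cons count_list_removeAll)

section \<open>Curvature over a common denominator and its rotation invariance\<close>

definition balance :: "'a \<Rightarrow> 'a \<Rightarrow> 'a list \<Rightarrow> rat" where
  "balance x y u = of_nat (precedences y x u) - of_nat (precedences x y u)"

lemma Ind_removeAll:
  assumes "x \<noteq> z" "y \<noteq> z"
  shows "Ind x y (removeAll z u) =
    balance x y u / (2 * of_nat (count_list u x) * of_nat (count_list u y))"
  using assms unfolding Ind_def balance_def card_occ_greater precedences_def[symmetric]
  by (simp add: card_occ count_list_removeAll precedences_removeAll)

lemma Curv_eq:
  assumes "distinct [a, b, c]" "{a, b, c} \<subseteq> set w"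
  shows "Curv a b c w =
    (balance b c w * of_nat (count_list w a) - balance a c w * of_nat (count_list w b)
      + balance a b w * of_nat (count_list w c))
    / (2 * of_nat (count_list w a) * of_nat (count_list w b) * of_nat (count_list w c))"
proof -
  \<comment> \<open>Each fraction is expanded by the count of the letter it lacks, which must be
    nonzero.\<close>
  have "count_list w a \<noteq> 0" "count_list w b \<noteq> 0" "count_list w c \<noteq> 0"
    using assms(2) by (auto simp: count_list_0_iff)
  then show ?thesis
    using assms(1)
    by (auto simp: Curv_def Ind_removeAll[of b a c] Ind_removeAll[of a b c] Ind_removeAll[of a c b]
        field_simps)
qed

lemma count_list_rotate1 [simp]: "count_list (rotate1 w) x = count_list w x"
  by (cases w) auto

text \<open>Moving a head \<open>x\<close> to the end reverses its order with every
  \<open>y\<close>, and each reversed pair changes the difference by 2; a head \<open>y\<close> does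
  the opposite.\<close>

lemma balance_rotate1:
  assumes "x \<noteq> y"
  shows "balance x y (rotate1 (z # u)) = balance x y (z # u)
    + (if z = x then 2 * of_nat (count_list (z # u) y) else 0)
    - (if z = y then 2 * of_nat (count_list (z # u) x) else 0)"
  using assms by (auto simp: balance_def precedences_Cons precedences_snoc)

lemma Curv_rotate1:
  assumes "distinct [a, b, c]" "{a, b, c} \<subseteq> set w"
  shows "Curv a b c (rotate1 w) = Curv a b c w"
proof (cases w)
  case (Cons z u)
  \<comment> \<open>If the head is \<open>a\<close>, the last two terms change by minus and plus
    twice the product of the counts of \<open>b\<close> and \<open>c\<close>; heads \<open>b\<close>
    and \<open>c\<close> are similar. The deleted simp rules keep the terms in the shape of
    \<open>balance_rotate1\<close>.\<close>
  have "balance b c (rotate1 w) * of_nat (count_list w a)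
      - balance a c (rotate1 w) * of_nat (count_list w b)
      + balance a b (rotate1 w) * of_nat (count_list w c)
    = balance b c w * of_nat (count_list w a) - balance a c w * of_nat (count_list w b)
      + balance a b w * of_nat (count_list w c)"
    using assms(1) unfolding Cons
    by (auto simp: balance_rotate1 algebra_simps simp del: rotate1.simps count_list.simps)
  then show ?thesis
    using assms by (simp add: Curv_eq)
qed simp

lemma Curv_rotate:
  assumes "distinct [a, b, c]" "{a, b, c} \<subseteq> set w"
  shows "Curv a b c (rotate n w) = Curv a b c w"
  using assms by (induction n) (simp_all add: Curv_rotate1)

section \<open>Triangles as a sum of signs\<close>

lemma of_nat_card_Collect:
  "finite A \<Longrightarrow> of_nat (card {t \<in> A. P t}) = (\<Sum>t\<in>A. of_bool (P t))"
  by (simp add: of_bool_def sum.If_cases Int_def)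

lemma balance_eq_sum:
  "balance x y u = (\<Sum>i\<in>occ x u. \<Sum>j\<in>occ y u. of_bool (i > j) - of_bool (i < j))"
proof -
  have *: "of_nat (card {(i, j) \<in> occ x u \<times> occ y u. P i j})
      = (\<Sum>i\<in>occ x u. \<Sum>j\<in>occ y u. of_bool (P i j) :: rat)" for P
  proof -
    have "{(i, j) \<in> occ x u \<times> occ y u. P i j} = {t \<in> occ x u \<times> occ y u. P (fst t) (snd t)}"
      by auto
    then show ?thesis
      by (simp only: of_nat_card_Collect finite_cartesian_product finite_occ sum.cartesian_product
          case_prod_unfold)
  qed
  show ?thesis
    unfolding balance_def card_occ_greater[of x u y, symmetric] precedences_def[of x y]
    by (simp only: * sum_subtractf)
qed

lemma triangle_difference:
  assumes "distinct [a, b, c]"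
  shows "of_nat (t_minus a b c w) - of_nat (t_plus a b c w) =
    balance b c w * of_nat (count_list w a) - balance a c w * of_nat (count_list w b)
      + balance a b w * of_nat (count_list w c)"
proof -
  let ?s = "\<lambda>p q. of_bool (p > q) - of_bool (p < q) :: rat"
  have fin: "finite (triangles a b c w)"
    by (simp add: triangles_def)
  have "of_nat (t_minus a b c w) - of_nat (t_plus a b c w)
      = (\<Sum>t\<in>triangles a b c w. of_bool (\<not> oriented t) - of_bool (oriented t) :: rat)"
    unfolding t_minus_def t_plus_def of_nat_card_Collect[OF fin] by (simp add: sum_subtractf)
  also have "\<dots> = (\<Sum>(i, j, k)\<in>triangles a b c w. ?s j k - ?s i k + ?s i j)"
  proof (intro sum.cong refl, clarify)
    fix i j k assume "(i, j, k) \<in> triangles a b c w"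
    then have "i \<noteq> j" "j \<noteq> k" "i \<noteq> k"
      using assms by (auto simp: triangles_def occ_def)
    \<comment> \<open>At distinct positions \<open>- ?s i k\<close> equals \<open>?s k i\<close>, so
      the right side is cyclically symmetric in \<open>i\<close>, \<open>j\<close>,
      \<open>k\<close>, and reversing the order negates it.\<close>
    then show "of_bool (\<not> oriented (i, j, k)) - of_bool (oriented (i, j, k))
        = ?s j k - ?s i k + ?s i j"
      by (auto simp: oriented_def)
  qed
  also have "\<dots> = (\<Sum>i\<in>occ a w. \<Sum>j\<in>occ b w. \<Sum>k\<in>occ c w. ?s j k - ?s i k + ?s i j)"
    by (simp add: triangles_def sum.cartesian_product)
  also have "\<dots> = (\<Sum>i\<in>occ a w. \<Sum>j\<in>occ b w. \<Sum>k\<in>occ c w. ?s j k)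
      - (\<Sum>i\<in>occ a w. \<Sum>j\<in>occ b w. \<Sum>k\<in>occ c w. ?s i k)
      + (\<Sum>i\<in>occ a w. \<Sum>j\<in>occ b w. \<Sum>k\<in>occ c w. ?s i j)"
    by (simp only: sum.distrib sum_subtractf)
  \<comment> \<open>In each triple sum one index is absent from the summand; summing over it gives
    the count of its letter.\<close>
  also have "\<dots> = balance b c w * of_nat (count_list w a) - balance a c w * of_nat (count_list w b)
      + balance a b w * of_nat (count_list w c)"
    unfolding balance_eq_sum card_occ[symmetric] sum_constant sum_distrib_left[symmetric]
    by (simp only: mult.commute)
  finally show ?thesis .
qed

lemma triangle_total:
  "t_plus a b c w + t_minus a b c w = count_list w a * count_list w b * count_list w c"
proof -
  have fin: "finite (triangles a b c w)"
    by (simp add: triangles_def)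
  have "t_plus a b c w + t_minus a b c w = card (triangles a b c w)"
    unfolding t_plus_def t_minus_def
    by (subst card_Un_disjoint[symmetric]) (auto simp: fin intro: arg_cong[where f = card])
  then show ?thesis
    by (simp add: triangles_def card_cartesian_product card_occ)
qed

lemma Curv_eq_triangles:
  assumes "distinct [a, b, c]" "{a, b, c} \<subseteq> set w"
  shows "Curv a b c w =
    - (of_nat (t_plus a b c w) - of_nat (t_minus a b c w))
    / (2 * (of_nat (t_plus a b c w) + of_nat (t_minus a b c w)))"
proof -
  have "of_nat (t_plus a b c w) + of_nat (t_minus a b c w)
      = (of_nat (count_list w a) * of_nat (count_list w b) * of_nat (count_list w c) :: rat)"
    using triangle_total[of a b c w] by (metis of_nat_add of_nat_mult)
  then show ?thesis
    using assms by (simp add: Curv_eq mult.assoc flip: triangle_difference)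
qed

theorem theorem2:
  fixes a b c :: "'a :: linorder" and w :: "'a list"
  assumes "a < b" and "b < c"
    and "set w = {a, b, c}"
  shows "Curv a b c (rotate1 w) = Curv a b c w
    \<and> (\<forall>v \<in> cyclic_word w. Curv a b c v = Curv a b c w)
    \<and> (\<forall>v \<in> cyclic_word w. Curv a b c w =
          - (of_nat (t_plus a b c v) - of_nat (t_minus a b c v))
          / (2 * (of_nat (t_plus a b c v) + of_nat (t_minus a b c v))))"
proof -
  have abc: "distinct [a, b, c]" and w: "{a, b, c} \<subseteq> set w"
    using assms by auto
  \<comment> \<open>A rotation \<open>v\<close> keeps all three letters, so the triangle formula
    applies to \<open>v\<close> itself and invariance carries it back to \<open>w\<close>.\<close>
  have inv: "Curv a b c v = Curv a b c w" and v: "{a, b, c} \<subseteq> set v" if "v \<in> cyclic_word w" for v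
    using that w by (auto simp: cyclic_word_def cyclic_rel_def Curv_rotate[OF abc w])
  then show ?thesis
    using Curv_rotate1[OF abc w] Curv_eq_triangles[OF abc] by metis
qed

end
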